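(* Let points $M_1,\dots,M_N\in\mathbb R^k$ with masses $m_1,\dots,m_N>0$ be given, not all contained in one hyperplane, with center of masses $C$, and let $w$ be a line (direction) in $\mathbb R^k$. Let the ray from $C$ in the direction $w$ intersect the data ellipsoid $\langle J_C^{-1}\mathbf x,\mathbf x\rangle=1$ at the point $W$ and let $\pi_W$ be the tangent hyperplane to the data ellipsoid at $W$. Then the directional hyperplane of regression in the direction $w$ contains $C$ and is parallel to the tangent hyperplane $\pi_W$.
   Context: The center of masses is $C=\frac1m\sum_i m_iM_i$, $m=\sum_i m_i$. The central hyperplanar operator of inertia $J_C$ is the symmetric operator with $\langle J_C\mathbf n_1,\mathbf n_2\rangle=\sum_{j} m_j\langle \mathbf r_j,\mathbf n_1\rangle\langle\mathbf r_j,\mathbf n_2\rangle$, $\mathbf r_j=M_j-C$. In the equation of the data ellipsoid, $\mathbf x$ is the radius vector from $C$ (the ellipsoid is centered at $C$). For a hyperplane $\pi$ not parallel to $w$, the hyperplanar moment of inertia in direction $w$ is $J^w_\pi=\sum_{j=1}^N m_j\hat D_j^2$, where $\hat D_j$ is the distance between $M_j$ and the intersection point of $\pi$ with the line through $M_j$ parallel to $w$. The directional hyperplane of regression in the direction $w$ is the hyperplane minimizing $J^w_\pi$ among all hyperplanes not parallel to $w$. *)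

theory Defs
  imports "HOL-Analysis.Analysis"
begin

definition is_hyperplane :: "'a::euclidean_space set \<Rightarrow> bool" where
  "is_hyperplane \<pi> \<longleftrightarrow> (\<exists>a b. a \<noteq> 0 \<and> \<pi> = {x. a \<bullet> x = b})"

text \<open>Directions are represented by nonzero vectors.\<close>

definition line_through :: "'a::euclidean_space \<Rightarrow> 'a \<Rightarrow> 'a set" where
  "line_through p w = {p + t *\<^sub>R w | t. True}"

definition ray_from :: "'a::euclidean_space \<Rightarrow> 'a \<Rightarrow> 'a set" where
  "ray_from p w = {p + t *\<^sub>R w | t. 0 \<le> t}"

text \<open>A hyperplane containing a line of direction \<open>w\<close> counts as parallel to \<open>w\<close>.\<close>

definition parallel_to_direction :: "'a::euclidean_space set \<Rightarrow> 'a \<Rightarrow> bool" where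
  "parallel_to_direction \<pi> w \<longleftrightarrow> (\<forall>x\<in>\<pi>. line_through x w \<subseteq> \<pi>)"

definition center_of_masses ::
    "nat \<Rightarrow> (nat \<Rightarrow> real) \<Rightarrow> (nat \<Rightarrow> 'a::euclidean_space) \<Rightarrow> 'a" where
  "center_of_masses N m M = (1 / (\<Sum>j=1..N. m j)) *\<^sub>R (\<Sum>j=1..N. m j *\<^sub>R M j)"

definition inertia_operator ::
    "nat \<Rightarrow> (nat \<Rightarrow> real) \<Rightarrow> (nat \<Rightarrow> 'a::euclidean_space) \<Rightarrow> 'a \<Rightarrow> 'a" where
  "inertia_operator N m M = (THE J. linear J \<and>
     (\<forall>n1 n2. J n1 \<bullet> n2 = (\<Sum>j=1..N. m j *
        ((M j - center_of_masses N m M) \<bullet> n1) * ((M j - center_of_masses N m M) \<bullet> n2))))"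

lemma inertia_operator_eq:
  "inertia_operator N m M n =
     (\<Sum>j=1..N. (m j * ((M j - center_of_masses N m M) \<bullet> n)) *\<^sub>R (M j - center_of_masses N m M))"
proof -
  let ?r = "\<lambda>j. M j - center_of_masses N m M"
  let ?J = "\<lambda>n. \<Sum>j=1..N. (m j * (?r j \<bullet> n)) *\<^sub>R ?r j"
  have lin: "linear ?J"
    by (rule linearI)
       (simp_all add: inner_add_right distrib_left scaleR_add_left sum.distrib scaleR_sum_right
          mult.left_commute)
  have form: "?J n1 \<bullet> n2 = (\<Sum>j=1..N. m j * (?r j \<bullet> n1) * (?r j \<bullet> n2))" for n1 n2
    by (simp add: inner_sum_left)
  have "inertia_operator N m M = ?J"
    unfolding inertia_operator_def
  proof (rule the_equality)
    show "linear ?J \<and> (\<forall>n1 n2. ?J n1 \<bullet> n2 = (\<Sum>j=1..N. m j * (?r j \<bullet> n1) * (?r j \<bullet> n2)))"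
      using lin form by blast
  next
    fix J assume J: "linear J \<and>
      (\<forall>n1 n2. J n1 \<bullet> n2 = (\<Sum>j=1..N. m j * (?r j \<bullet> n1) * (?r j \<bullet> n2)))"
    show "J = ?J"
    proof
      fix x
      have "J x \<bullet> y = ?J x \<bullet> y" for y
        using J form[of x y] by metis
      then show "J x = ?J x"
        by (metis vector_eq_rdot)
    qed
  qed
  then show ?thesis by simp
qed

text \<open>The inertia operator is invertible when the points are not contained in one hyperplane.\<close>

definition data_ellipsoid ::
    "nat \<Rightarrow> (nat \<Rightarrow> real) \<Rightarrow> (nat \<Rightarrow> 'a::euclidean_space) \<Rightarrow> 'a set" where
  "data_ellipsoid N m M =
     {center_of_masses N m M + x | x. inv (inertia_operator N m M) x \<bullet> x = 1}"

text \<open>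
  Tangent vectors are the velocities of curves lying in the hypersurface. Only differentiability
  at the base point is required, and the curve is defined on the whole real line; for an embedded
  hypersurface neither choice changes the set of velocities.
\<close>

definition tangent_vectors :: "'a::euclidean_space set \<Rightarrow> 'a \<Rightarrow> 'a set" where
  "tangent_vectors S p = {v. \<exists>\<gamma>::real \<Rightarrow> 'a.
     (\<forall>t. \<gamma> t \<in> S) \<and> \<gamma> 0 = p \<and> (\<gamma> has_vector_derivative v) (at 0)}"

definition tangent_hyperplane :: "'a::euclidean_space set \<Rightarrow> 'a \<Rightarrow> 'a set" where
  "tangent_hyperplane S p = {p + v | v. v \<in> tangent_vectors S p}"

text \<open>The intersection point exists and is unique for a hyperplane not parallel to \<open>w\<close>.\<close>

definition directional_dist :: "'a::euclidean_space set \<Rightarrow> 'a \<Rightarrow> 'a \<Rightarrow> real" where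
  "directional_dist \<pi> w p = dist p (THE q. q \<in> \<pi> \<inter> line_through p w)"

definition directional_moment ::
    "nat \<Rightarrow> (nat \<Rightarrow> real) \<Rightarrow> (nat \<Rightarrow> 'a::euclidean_space) \<Rightarrow> 'a \<Rightarrow> 'a set \<Rightarrow> real" where
  "directional_moment N m M w \<pi> = (\<Sum>j=1..N. m j * (directional_dist \<pi> w (M j))\<^sup>2)"

definition is_directional_regression_hyperplane ::
    "nat \<Rightarrow> (nat \<Rightarrow> real) \<Rightarrow> (nat \<Rightarrow> 'a::euclidean_space) \<Rightarrow> 'a \<Rightarrow> 'a set \<Rightarrow> bool" where
  "is_directional_regression_hyperplane N m M w \<pi> \<longleftrightarrow>
     is_arg_min (directional_moment N m M w)
       (\<lambda>\<pi>'. is_hyperplane \<pi>' \<and> \<not> parallel_to_direction \<pi>' w) \<pi>"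

end

theory Submission imports Defs begin

text \<open>
  A hyperplane that is not parallel to \<open>w\<close> has a unique equation \<open>a \<bullet> x = b\<close> with the
  normalisation \<open>a \<bullet> w = 1\<close>. The line through \<open>p\<close> of direction \<open>w\<close> then meets it at the signed
  parameter \<open>b - a \<bullet> p\<close>, so the moment to be minimised is \<open>(norm w)\<^sup>2\<close> times
  \<open>\<Sum>j. m j * (b - a \<bullet> M j)\<^sup>2\<close>. Splitting off the center of masses \<open>C\<close> (Huygens--Steiner) turns
  this sum into \<open>J a \<bullet> a + (\<Sum>j. m j) * (b - a \<bullet> C)\<^sup>2\<close>, where \<open>J\<close> is the operator of inertia
  (\<open>directional_moment_normalised\<close>).

  Because the points span, \<open>J\<close> is positive definite. Hence the optimal \<open>b\<close> is \<open>a \<bullet> C\<close>, which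
  puts \<open>C\<close> on the hyperplane, and it remains to minimise a positive definite quadratic form on
  the affine hyperplane \<open>a \<bullet> w = 1\<close>. Completing the square
  (\<open>quadratic_form_on_affine_hyperplane\<close>) shows that the only minimiser is the multiple of
  \<open>J\<^sup>-\<^sup>1 w\<close> that satisfies the constraint.

  On the other side, the tangent space of the ellipsoid \<open>J\<^sup>-\<^sup>1 x \<bullet> x = 1\<close> at a point \<open>x\<close> is the
  orthogonal complement of the gradient direction \<open>J\<^sup>-\<^sup>1 x\<close> (\<open>tangent_vectors_quadric\<close>). At
  \<open>W - C\<close>, a multiple of \<open>w\<close>, this normal is again a multiple of \<open>J\<^sup>-\<^sup>1 w\<close>; the two
  hyperplanes have a common normal and are therefore parallel.
\<close>

section \<open>Positive definite symmetric operators\<close>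

lemma inv_symmetric_posdef:
  fixes J :: "'a::euclidean_space \<Rightarrow> 'a"
  assumes lin: "linear J"
    and sym: "\<And>x y. J x \<bullet> y = x \<bullet> J y"
    and pos: "\<And>x. x \<noteq> 0 \<Longrightarrow> J x \<bullet> x > 0"
  shows "linear (inv J)" and "J (inv J x) = x"
    and "inv J x \<bullet> y = x \<bullet> inv J y"
    and "x \<noteq> 0 \<Longrightarrow> inv J x \<bullet> x > 0"
proof -
  have "inj J"
    unfolding linear_injective_0[OF lin] by (metis inner_zero_left less_irrefl pos)
  then have "bij J"
    using linear_injective_imp_surjective[OF lin] by (simp add: bij_def)
  then show J_inv: "J (inv J x) = x" for x
    by (simp add: bij_is_surj surj_f_inv_f)
  have inv_J: "inv J (J x) = x" for x
    using \<open>inj J\<close> by simp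
  show "linear (inv J)"
  proof (rule linearI)
    fix u v c
    have "J (inv J u + inv J v) = u + v" "J (c *\<^sub>R inv J u) = c *\<^sub>R u"
      by (simp_all add: linear_add[OF lin] linear_scale[OF lin] J_inv)
    then show "inv J (u + v) = inv J u + inv J v" "inv J (c *\<^sub>R u) = c *\<^sub>R inv J u"
      using inv_J by metis+
  qed
  show "inv J x \<bullet> y = x \<bullet> inv J y"
    by (metis J_inv sym)
  assume "x \<noteq> 0"
  then have "inv J x \<noteq> 0"
    by (metis J_inv lin linear_0)
  then show "inv J x \<bullet> x > 0"
    using pos[of "inv J x"] by (simp add: J_inv inner_commute)
qed

text \<open>
  The vector \<open>a0\<close> is the critical point found by Lagrange multipliers: \<open>J a0\<close> is proportional to
  the normal \<open>w\<close> of the constraint \<open>a \<bullet> w = 1\<close>. Consequently \<open>a - a0\<close> is orthogonal to \<open>J a0\<close>,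
  and the mixed terms vanish in the expansion around \<open>a0\<close>.
\<close>

lemma quadratic_form_on_affine_hyperplane:
  fixes J :: "'a::euclidean_space \<Rightarrow> 'a"
  assumes lin: "linear J"
    and sym: "\<And>x y. J x \<bullet> y = x \<bullet> J y"
    and crit: "J a0 = c *\<^sub>R w"
    and "a0 \<bullet> w = 1" "a \<bullet> w = 1"
  shows "J a \<bullet> a = J a0 \<bullet> a0 + J (a - a0) \<bullet> (a - a0)"
proof -
  have "J a0 \<bullet> a = c" "J a0 \<bullet> a0 = c"
    using assms by (simp_all add: inner_commute)
  moreover have "J a \<bullet> a0 = J a0 \<bullet> a"
    using sym by (simp add: inner_commute)
  ultimately show ?thesis
    by (simp add: linear_diff[OF lin] inner_diff_left inner_diff_right)
qed

section \<open>Tangent vectors of a central quadric\<close>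

text \<open>
  Differentiating \<open>K x \<bullet> x = 1\<close> along a curve shows that velocities are orthogonal to \<open>K x0\<close>.
  Conversely, a vector \<open>v\<close> orthogonal to \<open>K x0\<close> is the velocity of the line \<open>x0 + t v\<close> projected
  radially to the quadric: the form takes the value \<open>1 + t\<^sup>2 (K v \<bullet> v)\<close> on that line, so the
  radial factor is defined for all \<open>t\<close> and has derivative \<open>0\<close> at \<open>t = 0\<close>.
\<close>

lemma tangent_vectors_quadric:
  fixes K :: "'a::euclidean_space \<Rightarrow> 'a"
  assumes lin: "linear K"
    and sym: "\<And>x y. K x \<bullet> y = x \<bullet> K y"
    and nonneg: "\<And>x. K x \<bullet> x \<ge> 0"
    and x0: "K x0 \<bullet> x0 = 1"
  shows "tangent_vectors {c + x | x. K x \<bullet> x = 1} (c + x0) = {v. K x0 \<bullet> v = 0}"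
proof (rule set_eqI, rule iffI)
  fix v assume "v \<in> tangent_vectors {c + x | x. K x \<bullet> x = 1} (c + x0)"
  then obtain \<gamma> :: "real \<Rightarrow> 'a" where on: "\<And>t. \<gamma> t \<in> {c + x | x. K x \<bullet> x = 1}"
    and at0: "\<gamma> 0 = c + x0" and deriv: "(\<gamma> has_vector_derivative v) (at 0)"
    unfolding tangent_vectors_def by blast
  define \<delta> where "\<delta> t = \<gamma> t - c" for t
  have d: "(\<delta> has_vector_derivative v) (at 0)"
    unfolding \<delta>_def using has_vector_derivative_diff[OF deriv has_vector_derivative_const[of c]]
    by simp
  have Kd: "((\<lambda>t. K (\<delta> t)) has_vector_derivative K v) (at 0)"
    using bounded_linear.has_vector_derivative[OF linear_conv_bounded_linear[THEN iffD1, OF lin] d] .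
  have "((\<lambda>t. K (\<delta> t) \<bullet> \<delta> t) has_vector_derivative (K (\<delta> 0) \<bullet> v + K v \<bullet> \<delta> 0)) (at 0)"
    using bounded_bilinear.has_vector_derivative[OF bounded_bilinear_inner Kd d] .
  moreover have "(\<lambda>t. K (\<delta> t) \<bullet> \<delta> t) = (\<lambda>t. 1)"
  proof
    fix t show "K (\<delta> t) \<bullet> \<delta> t = 1"
      using on[of t] by (auto simp: \<delta>_def)
  qed
  ultimately have "K (\<delta> 0) \<bullet> v + K v \<bullet> \<delta> 0 = 0"
    using has_vector_derivative_const vector_derivative_unique_at by metis
  moreover have "K v \<bullet> \<delta> 0 = K (\<delta> 0) \<bullet> v"
    using sym[of v "\<delta> 0"] by (simp only: inner_commute)
  ultimately show "v \<in> {v. K x0 \<bullet> v = 0}"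
    by (simp add: \<delta>_def at0)
next
  fix v assume "v \<in> {v. K x0 \<bullet> v = 0}"
  then have orth: "K x0 \<bullet> v = 0" "K v \<bullet> x0 = 0"
    using sym[of v x0] by (simp_all only: mem_Collect_eq inner_commute)
  define f where "f t = 1 / sqrt (1 + t\<^sup>2 * (K v \<bullet> v))" for t
  define \<gamma> where "\<gamma> t = c + f t *\<^sub>R (x0 + t *\<^sub>R v)" for t
  have pos: "1 + t\<^sup>2 * (K v \<bullet> v) > 0" for t
    using nonneg[of v] by (simp add: add_pos_nonneg)
  have line: "K (x0 + t *\<^sub>R v) \<bullet> (x0 + t *\<^sub>R v) = 1 + t\<^sup>2 * (K v \<bullet> v)" for t
    using orth x0 lin
    by (simp add: linear_add linear_scale inner_add_left inner_add_right power2_eq_square)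
  have "\<gamma> t \<in> {c + x | x. K x \<bullet> x = 1}" for t
  proof -
    have "(f t)\<^sup>2 * (1 + t\<^sup>2 * (K v \<bullet> v)) = 1"
      using pos[of t] by (simp add: f_def power_divide)
    then have "K (f t *\<^sub>R (x0 + t *\<^sub>R v)) \<bullet> (f t *\<^sub>R (x0 + t *\<^sub>R v)) = 1"
      using line[of t] by (simp add: linear_scale[OF lin] power2_eq_square mult.assoc)
    then show ?thesis
      unfolding \<gamma>_def by blast
  qed
  moreover have "\<gamma> 0 = c + x0"
    by (simp add: \<gamma>_def f_def)
  moreover have "(\<gamma> has_vector_derivative v) (at 0)"
  proof -
    have f': "(f has_real_derivative 0) (at 0)"
      unfolding f_def by (auto intro!: derivative_eq_intros)
    have l': "((\<lambda>t. x0 + t *\<^sub>R v) has_vector_derivative v) (at 0)"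
      by (auto intro!: derivative_eq_intros simp: has_vector_derivative_def)
    have "((\<lambda>t. f t *\<^sub>R (x0 + t *\<^sub>R v)) has_vector_derivative v) (at 0)"
      using has_vector_derivative_scaleR[OF f' l'] by (simp add: f_def)
    then show ?thesis
      unfolding \<gamma>_def
      using has_vector_derivative_add[OF has_vector_derivative_const[of c]] by fastforce
  qed
  ultimately show "v \<in> tangent_vectors {c + x | x. K x \<bullet> x = 1} (c + x0)"
    unfolding tangent_vectors_def by blast
qed

section \<open>Hyperplanes transversal to a direction\<close>

lemma transversal_hyperplane_iff:
  fixes w :: "'a::euclidean_space"
  shows "is_hyperplane \<pi> \<and> \<not> parallel_to_direction \<pi> w \<longleftrightarrow>
    (\<exists>a b. a \<bullet> w = 1 \<and> \<pi> = {x. a \<bullet> x = b})"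
proof
  assume "is_hyperplane \<pi> \<and> \<not> parallel_to_direction \<pi> w"
  then obtain a b where \<pi>: "\<pi> = {x. a \<bullet> x = b}" and "\<not> parallel_to_direction \<pi> w"
    by (auto simp: is_hyperplane_def)
  then have "a \<bullet> w \<noteq> 0"
    by (auto simp: parallel_to_direction_def line_through_def inner_add_right)
  then have "((1 / (a \<bullet> w)) *\<^sub>R a) \<bullet> w = 1" "\<pi> = {x. ((1 / (a \<bullet> w)) *\<^sub>R a) \<bullet> x = b / (a \<bullet> w)}"
    by (auto simp: \<pi>)
  then show "\<exists>a b. a \<bullet> w = 1 \<and> \<pi> = {x. a \<bullet> x = b}"
    by blast
next
  assume "\<exists>a b. a \<bullet> w = 1 \<and> \<pi> = {x. a \<bullet> x = b}"
  then obtain a b where aw: "a \<bullet> w = 1" and \<pi>: "\<pi> = {x. a \<bullet> x = b}"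
    by blast
  have "a \<noteq> 0"
    using aw by auto
  moreover have "b *\<^sub>R w \<in> \<pi>" "b *\<^sub>R w + 1 *\<^sub>R w \<notin> \<pi>"
    using aw by (simp_all add: \<pi> inner_add_right)
  ultimately show "is_hyperplane \<pi> \<and> \<not> parallel_to_direction \<pi> w"
    unfolding is_hyperplane_def parallel_to_direction_def line_through_def \<pi> by blast
qed

lemma directional_dist_normalised:
  fixes w :: "'a::euclidean_space"
  assumes "a \<bullet> w = 1"
  shows "directional_dist {x. a \<bullet> x = b} w p = \<bar>b - a \<bullet> p\<bar> * norm w"
proof -
  have "(THE q. q \<in> {x. a \<bullet> x = b} \<inter> line_through p w) = p + (b - a \<bullet> p) *\<^sub>R w"
    by (rule the_equality) (use assms in \<open>auto simp: line_through_def inner_add_right\<close>)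
  then show ?thesis
    by (simp add: directional_dist_def dist_norm)
qed

section \<open>The operator of inertia and the directional moment\<close>

lemma inertia_operator_inner:
  "inertia_operator N m M x \<bullet> y = (\<Sum>j=1..N. m j *
     ((M j - center_of_masses N m M) \<bullet> x) * ((M j - center_of_masses N m M) \<bullet> y))"
  by (simp add: inertia_operator_eq inner_sum_left)

lemma linear_inertia_operator: "linear (inertia_operator N m M)"
  by (rule linearI)
    (simp_all add: inertia_operator_eq inner_add_right distrib_left scaleR_add_left sum.distrib
      scaleR_sum_right mult.left_commute)

lemma inertia_operator_symmetric:
  "inertia_operator N m M x \<bullet> y = x \<bullet> inertia_operator N m M y"
  by (simp add: inertia_operator_inner inner_commute[of x] mult.commute mult.left_commute)

text \<open>
  If the form vanished at \<open>x \<noteq> 0\<close>, every point would lie in the hyperplane through the center of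
  masses with normal \<open>x\<close>.
\<close>

lemma inertia_operator_posdef:
  assumes masses: "\<And>j. j \<in> {1..N} \<Longrightarrow> m j > 0"
    and spanning: "\<not> (\<exists>\<pi>. is_hyperplane \<pi> \<and> M ` {1..N} \<subseteq> \<pi>)"
    and "x \<noteq> 0"
  shows "inertia_operator N m M x \<bullet> x > 0"
proof -
  let ?r = "\<lambda>j. M j - center_of_masses N m M"
  let ?\<pi> = "{y. x \<bullet> y = x \<bullet> center_of_masses N m M}"
  have "is_hyperplane ?\<pi>"
    using \<open>x \<noteq> 0\<close> by (auto simp: is_hyperplane_def)
  then obtain j where j: "j \<in> {1..N}" "M j \<notin> ?\<pi>"
    using spanning by blast
  then have "?r j \<bullet> x \<noteq> 0"
    by (simp add: inner_diff_right inner_commute[of _ x])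
  then have "0 < m j * (?r j \<bullet> x) * (?r j \<bullet> x)"
    using masses[OF j(1)] by (simp add: mult.assoc zero_less_mult_iff linorder_neq_iff disj_commute)
  moreover have "0 \<le> m i * (?r i \<bullet> x) * (?r i \<bullet> x)" if "i \<in> {1..N}" for i
    using masses[OF that] by (simp add: mult.assoc)
  ultimately show ?thesis
    unfolding inertia_operator_inner using j(1) by (intro sum_pos2) auto
qed

text \<open>
  This is the Huygens--Steiner theorem for the offset of the hyperplane: the mixed term
  disappears because \<open>\<Sum>j. m j (M j - C) = 0\<close>.
\<close>

lemma directional_moment_normalised:
  fixes w :: "'a::euclidean_space"
  assumes mass: "(\<Sum>j=1..N. m j) \<noteq> 0" and aw: "a \<bullet> w = 1"
  shows "directional_moment N m M w {x. a \<bullet> x = b} =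
    (norm w)\<^sup>2 * (inertia_operator N m M a \<bullet> a +
      (\<Sum>j=1..N. m j) * (b - a \<bullet> center_of_masses N m M)\<^sup>2)"
proof -
  let ?C = "center_of_masses N m M"
  let ?r = "\<lambda>j. M j - ?C"
  let ?d = "b - a \<bullet> ?C"
  have "(\<Sum>j=1..N. m j) *\<^sub>R ?C = (\<Sum>j=1..N. m j *\<^sub>R M j)"
    using mass by (simp add: center_of_masses_def)
  then have "(\<Sum>j=1..N. m j *\<^sub>R ?r j) = 0"
    by (simp add: scaleR_diff_right sum_subtractf scaleR_sum_left)
  then have "(\<Sum>j=1..N. m j *\<^sub>R ?r j) \<bullet> a = 0"
    by simp
  then have mixed: "(\<Sum>j=1..N. m j * (?r j \<bullet> a)) = 0"
    by (simp add: inner_sum_left)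
  have square: "c * ((d - r)\<^sup>2 * n\<^sup>2) = n\<^sup>2 * (c * r * r + c * d\<^sup>2 - 2 * d * (c * r))"
    for c d r n :: real
    by (simp add: power2_eq_square algebra_simps)
  have "directional_moment N m M w {x. a \<bullet> x = b} =
      (\<Sum>j=1..N. (norm w)\<^sup>2 * (m j * (?r j \<bullet> a) * (?r j \<bullet> a) + m j * ?d\<^sup>2
         - 2 * ?d * (m j * (?r j \<bullet> a))))"
    unfolding directional_moment_def directional_dist_normalised[OF aw]
  proof (rule sum.cong[OF refl])
    fix j
    have "b - a \<bullet> M j = ?d - ?r j \<bullet> a"
      by (simp add: inner_diff_right inner_commute[of _ a])
    then show "m j * (\<bar>b - a \<bullet> M j\<bar> * norm w)\<^sup>2 =
        (norm w)\<^sup>2 * (m j * (?r j \<bullet> a) * (?r j \<bullet> a) + m j * ?d\<^sup>2 - 2 * ?d * (m j * (?r j \<bullet> a)))"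
      by (simp only: power_mult_distrib power2_abs square)
  qed
  also have "\<dots> = (norm w)\<^sup>2 * (inertia_operator N m M a \<bullet> a + (\<Sum>j=1..N. m j) * ?d\<^sup>2
      - 2 * ?d * (\<Sum>j=1..N. m j * (?r j \<bullet> a)))"
    unfolding sum_distrib_left[symmetric] sum_subtractf sum.distrib inertia_operator_inner
      sum_distrib_right[symmetric] ..
  finally show ?thesis
    using mixed by simp
qed

section \<open>The directional hyperplane of regression\<close>

text \<open>
  With \<open>a0 = J\<^sup>-\<^sup>1 w / (J\<^sup>-\<^sup>1 w \<bullet> w)\<close> and \<open>b0 = a0 \<bullet> C\<close>, the excess of the moment of any other
  transversal hyperplane over that of \<open>a0 \<bullet> x = b0\<close> is a positive multiple of
  \<open>J (a - a0) \<bullet> (a - a0) + (\<Sum>j. m j) * (b - a \<bullet> C)\<^sup>2\<close>, which vanishes only for \<open>a = a0\<close> and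
  \<open>b = b0\<close>.
\<close>

lemma directional_regression_hyperplane_iff:
  fixes w :: "'a::euclidean_space"
  assumes masses: "\<And>j. j \<in> {1..N} \<Longrightarrow> m j > 0"
    and spanning: "\<not> (\<exists>\<pi>. is_hyperplane \<pi> \<and> M ` {1..N} \<subseteq> \<pi>)"
    and "w \<noteq> 0"
  shows "is_directional_regression_hyperplane N m M w \<pi> \<longleftrightarrow>
    \<pi> = {x. inv (inertia_operator N m M) w \<bullet> (x - center_of_masses N m M) = 0}"
proof -
  let ?J = "inertia_operator N m M"
  let ?C = "center_of_masses N m M"
  let ?F = "directional_moment N m M w"
  let ?mass = "\<Sum>j=1..N. m j"
  have posdef: "inertia_operator N m M x \<bullet> x > 0" if "x \<noteq> 0" for x
    using inertia_operator_posdef[OF masses spanning that] .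
  note inv = inv_symmetric_posdef[OF linear_inertia_operator inertia_operator_symmetric posdef]
  define s where "s = inv ?J w \<bullet> w"
  define a0 where "a0 = (1 / s) *\<^sub>R inv ?J w"
  define \<pi>0 where "\<pi>0 = {x. a0 \<bullet> x = a0 \<bullet> ?C}"
  have "s > 0"
    using inv(4) \<open>w \<noteq> 0\<close> unfolding s_def by blast
  then have a0w: "a0 \<bullet> w = 1"
    by (simp add: a0_def s_def)
  have Ja0: "?J a0 = (1 / s) *\<^sub>R w"
    by (simp add: a0_def linear_scale[OF linear_inertia_operator] inv(2))
  have "N \<noteq> 0"
  proof
    assume "N = 0"
    moreover have "is_hyperplane {x. w \<bullet> x = 0}"
      using \<open>w \<noteq> 0\<close> by (auto simp: is_hyperplane_def)
    ultimately show False
      using spanning by auto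
  qed
  then have mass: "?mass > 0"
    using masses by (intro sum_pos) auto
  have \<pi>0_eq: "\<pi>0 = {x. inv ?J w \<bullet> (x - ?C) = 0}"
    using \<open>s > 0\<close> by (auto simp: \<pi>0_def a0_def inner_diff_right)
  have F_diff: "?F {x. a \<bullet> x = b} = ?F \<pi>0 + (norm w)\<^sup>2 *
      (?J (a - a0) \<bullet> (a - a0) + ?mass * (b - a \<bullet> ?C)\<^sup>2)" if "a \<bullet> w = 1" for a b
    using mass that a0w unfolding \<pi>0_def
    by (simp add: directional_moment_normalised distrib_left
        quadratic_form_on_affine_hyperplane[OF linear_inertia_operator inertia_operator_symmetric
          Ja0 a0w that])
  have strict: "?F \<pi>0 < ?F {x. a \<bullet> x = b}" if "a \<bullet> w = 1" "{x. a \<bullet> x = b} \<noteq> \<pi>0" for a b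
  proof -
    have "a \<noteq> a0 \<or> b \<noteq> a \<bullet> ?C"
      using that(2) by (auto simp: \<pi>0_def)
    then have "?J (a - a0) \<bullet> (a - a0) + ?mass * (b - a \<bullet> ?C)\<^sup>2 > 0"
    proof (cases "a = a0")
      case True
      with \<open>a \<noteq> a0 \<or> b \<noteq> a \<bullet> ?C\<close> mass show ?thesis
        by (simp add: linear_0[OF linear_inertia_operator])
    next
      case False
      with posdef[of "a - a0"] mass show ?thesis
        by (simp add: add_pos_nonneg)
    qed
    then show ?thesis
      using F_diff[OF that(1), of b] \<open>w \<noteq> 0\<close> by simp
  qed
  have "is_directional_regression_hyperplane N m M w \<pi> \<longleftrightarrow> \<pi> = \<pi>0"
    unfolding is_directional_regression_hyperplane_def is_arg_min_def transversal_hyperplane_iff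
  proof
    assume "\<pi> = \<pi>0"
    then show "(\<exists>a b. a \<bullet> w = 1 \<and> \<pi> = {x. a \<bullet> x = b}) \<and>
        \<not> (\<exists>\<pi>'. (\<exists>a b. a \<bullet> w = 1 \<and> \<pi>' = {x. a \<bullet> x = b}) \<and> ?F \<pi>' < ?F \<pi>)"
      using a0w strict \<pi>0_def by (metis less_asym less_irrefl)
  next
    assume "(\<exists>a b. a \<bullet> w = 1 \<and> \<pi> = {x. a \<bullet> x = b}) \<and>
        \<not> (\<exists>\<pi>'. (\<exists>a b. a \<bullet> w = 1 \<and> \<pi>' = {x. a \<bullet> x = b}) \<and> ?F \<pi>' < ?F \<pi>)"
    then show "\<pi> = \<pi>0"
      using a0w strict \<pi>0_def by metis
  qed
  then show ?thesis
    by (simp only: \<pi>0_eq)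
qed

text \<open>
  The condition that \<open>W\<close> lies on the ellipsoid excludes the parameter \<open>0\<close> on the ray, so \<open>W - C\<close>
  is a nonzero multiple of \<open>w\<close> and the normal \<open>J\<^sup>-\<^sup>1 (W - C)\<close> of the tangent hyperplane is a
  nonzero multiple of \<open>J\<^sup>-\<^sup>1 w\<close>. The translation by \<open>W - C\<close> carries one hyperplane to the other.
\<close>

theorem theorem5p3:
  fixes N :: nat and m :: "nat \<Rightarrow> real" and M :: "nat \<Rightarrow> real ^ 'k" and w W :: "real ^ 'k"
  assumes masses: "\<And>j. j \<in> {1..N} \<Longrightarrow> m j > 0"
    and spanning: "\<not> (\<exists>\<pi>. is_hyperplane \<pi> \<and> M ` {1..N} \<subseteq> \<pi>)"
    and direction: "w \<noteq> 0"
    and W: "W \<in> ray_from (center_of_masses N m M) w \<inter> data_ellipsoid N m M"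
  shows "(\<exists>!\<pi>. is_directional_regression_hyperplane N m M w \<pi>) \<and>
    (\<forall>\<pi>. is_directional_regression_hyperplane N m M w \<pi> \<longrightarrow>
       center_of_masses N m M \<in> \<pi> \<and>
       affine_parallel \<pi> (tangent_hyperplane (data_ellipsoid N m M) W))"
proof -
  let ?C = "center_of_masses N m M"
  let ?K = "inv (inertia_operator N m M)"
  let ?\<pi> = "{x. ?K w \<bullet> (x - ?C) = 0}"
  have posdef: "inertia_operator N m M x \<bullet> x > 0" if "x \<noteq> 0" for x
    using inertia_operator_posdef[OF masses spanning that] .
  note K = inv_symmetric_posdef[OF linear_inertia_operator inertia_operator_symmetric posdef]
  have regression: "is_directional_regression_hyperplane N m M w \<pi> \<longleftrightarrow> \<pi> = ?\<pi>" for \<pi>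
    by (rule directional_regression_hyperplane_iff[OF masses spanning direction])
  obtain t where t: "W = ?C + t *\<^sub>R w"
    using W by (auto simp: ray_from_def)
  have on: "?K (t *\<^sub>R w) \<bullet> (t *\<^sub>R w) = 1"
    using W by (auto simp: data_ellipsoid_def t)
  then have "t \<noteq> 0"
    by auto
  have nonneg: "?K x \<bullet> x \<ge> 0" for x
    using K(4)[of x] by (cases "x = 0") auto
  have "tangent_vectors (data_ellipsoid N m M) W = {v. ?K (t *\<^sub>R w) \<bullet> v = 0}"
    unfolding data_ellipsoid_def t by (rule tangent_vectors_quadric[OF K(1) K(3) nonneg on])
  then have tangent: "tangent_vectors (data_ellipsoid N m M) W = {v. ?K w \<bullet> v = 0}"
    using \<open>t \<noteq> 0\<close> by (simp add: linear_scale[OF K(1)])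
  have "tangent_hyperplane (data_ellipsoid N m M) W = (+) (W - ?C) ` ?\<pi>"
  proof (rule set_eqI, rule iffI)
    fix y assume "y \<in> tangent_hyperplane (data_ellipsoid N m M) W"
    then obtain v where "y = W + v" "?K w \<bullet> v = 0"
      by (auto simp: tangent_hyperplane_def tangent)
    then have "y = (W - ?C) + (?C + v)" "?C + v \<in> ?\<pi>"
      by simp_all
    then show "y \<in> (+) (W - ?C) ` ?\<pi>"
      by (rule image_eqI)
  next
    fix y assume "y \<in> (+) (W - ?C) ` ?\<pi>"
    then obtain x where "y = W + (x - ?C)" "?K w \<bullet> (x - ?C) = 0"
      by auto
    then show "y \<in> tangent_hyperplane (data_ellipsoid N m M) W"
      unfolding tangent_hyperplane_def tangent by blast
  qed
  then have "affine_parallel ?\<pi> (tangent_hyperplane (data_ellipsoid N m M) W)"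
    unfolding affine_parallel_def by blast
  then show ?thesis
    unfolding regression by simp
qed

end
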